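(* Let $C_n$ be the cycle of order $n\geq 3$. Then $$rvcl(C_n)=\begin{cases} 3, & \text{for } n\in\{3,4,5,6,7\};\\ \lceil n/2\rceil-1, & \text{for } n\in\{9,11,12,13,15\};\\ \lceil n/2\rceil, & \text{for } n\in\{8,10,14\} \text{ or } n\geq 16.\end{cases}$$
   Context: All graphs are finite, simple, undirected and connected; $d(u,v)$ denotes the distance in $G$, and for $S\subseteq V(G)$, $d(v,S)=\min\{d(v,y): y\in S\}$. A path between $x$ and $y$ is a rainbow vertex path (with respect to a vertex coloring) if its internal vertices all receive distinct colors. A rainbow vertex $k$-coloring of $G$ is a map $c:V(G)\to\{1,\dots,k\}$ such that every two distinct vertices $x,y$ are joined by a rainbow vertex $x$–$y$ path. For $i\in\{1,\dots,k\}$ let $R_i$ be the set of vertices of color $i$, and $\Pi=\{R_1,\dots,R_k\}$ the resulting ordered partition of $V(G)$; the rainbow code of $v$ is $rc_\Pi(v)=(d(v,R_1),\dots,d(v,R_k))$. A rainbow vertex $k$-coloring is a locating rainbow $k$-coloring if $rc_\Pi(u)\neq rc_\Pi(v)$ for all distinct vertices $u,v$. The locating rainbow connection number $rvcl(G)$ is the smallest positive integer $k$ for which $G$ has a locating rainbow $k$-coloring. *)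

theory Defs
  imports Complex_Main "Graph_Theory.Graph_Theory"
begin

text \<open>
  Finite simple undirected graphs are the symmetric loop-free digraphs \<^locale>\<open>pair_graph\<close>,
  in which an edge is a pair of opposite arcs.
\<close>

locale connected_pair_graph = pair_graph G for G :: "'a pair_pre_digraph" +
  assumes connected: "connected (with_proj G)"
begin

definition gdist :: "'a \<Rightarrow> 'a \<Rightarrow> ereal" where
  "gdist u v = \<mu> (\<lambda>_. 1) u v"

text \<open>Only meaningful for nonempty \<open>S\<close>.\<close>

definition set_gdist :: "'a \<Rightarrow> 'a set \<Rightarrow> ereal" where
  "set_gdist v S = Min (gdist v ` S)"

definition rainbow_vertex_path :: "('a \<Rightarrow> nat) \<Rightarrow> 'a \<Rightarrow> ('a \<times> 'a) awalk \<Rightarrow> 'a \<Rightarrow> bool" where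
  "rainbow_vertex_path c x p y \<longleftrightarrow> apath x p y \<and> distinct (map c (inner_verts p))"

definition rainbow_vertex_coloring :: "nat \<Rightarrow> ('a \<Rightarrow> nat) \<Rightarrow> bool" where
  "rainbow_vertex_coloring k c \<longleftrightarrow>
     c \<in> pverts G \<rightarrow> {1..k} \<and>
     (\<forall>x \<in> pverts G. \<forall>y \<in> pverts G. x \<noteq> y \<longrightarrow> (\<exists>p. rainbow_vertex_path c x p y))"

definition color_class :: "('a \<Rightarrow> nat) \<Rightarrow> nat \<Rightarrow> 'a set" where
  "color_class c i = {v \<in> pverts G. c v = i}"

definition rainbow_code :: "nat \<Rightarrow> ('a \<Rightarrow> nat) \<Rightarrow> 'a \<Rightarrow> ereal list" where
  "rainbow_code k c v = map (\<lambda>i. set_gdist v (color_class c i)) [1..<k + 1]"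

text \<open>
  The color classes have to form a partition of the vertices, so all \<open>k\<close> colors are used;
  this is also what makes the distances in the rainbow codes well defined.
\<close>

definition locating_rainbow_coloring :: "nat \<Rightarrow> ('a \<Rightarrow> nat) \<Rightarrow> bool" where
  "locating_rainbow_coloring k c \<longleftrightarrow>
     rainbow_vertex_coloring k c \<and>
     (\<forall>i \<in> {1..k}. color_class c i \<noteq> {}) \<and>
     (\<forall>u \<in> pverts G. \<forall>v \<in> pverts G. u \<noteq> v \<longrightarrow> rainbow_code k c u \<noteq> rainbow_code k c v)"

definition rvcl :: nat where
  "rvcl = (LEAST k. k \<ge> 1 \<and> (\<exists>c. locating_rainbow_coloring k c))"

end

definition cycle_graph :: "nat \<Rightarrow> nat pair_pre_digraph" where
  "cycle_graph n =
     \<lparr>pverts = {0..<n},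
      parcs = {(i, j). i < n \<and> j < n \<and> (j = (i + 1) mod n \<or> i = (j + 1) mod n)}\<rparr>"

lemma pair_graph_cycle_graph:
  assumes "n \<ge> 3"
  shows "pair_graph (cycle_graph n)"
proof
  show "finite (parcs (cycle_graph n))"
    by (rule finite_subset[of _ "{0..<n} \<times> {0..<n}"]) (auto simp: cycle_graph_def)
  show "symmetric (with_proj (cycle_graph n))"
    by (auto simp: symmetric_def cycle_graph_def intro!: symI)
  show "fst e \<noteq> snd e" if "e \<in> parcs (cycle_graph n)" for e
    using that assms by (auto simp: cycle_graph_def mod_Suc split: if_splits)
qed (auto simp: cycle_graph_def)

lemma connected_pair_graph_cycle_graph:
  assumes "n \<ge> 3"
  shows "connected_pair_graph (cycle_graph n)"
proof -
  interpret pair_graph "cycle_graph n" using assms by (rule pair_graph_cycle_graph)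
  have vs: "pverts (cycle_graph n) = {0..<n}" by (simp add: cycle_graph_def)
  have from0: "0 \<rightarrow>\<^sup>*\<^bsub>with_proj (cycle_graph n)\<^esub> i" if "i < n" for i
    using that
  proof (induction i)
    case 0
    then show ?case using vs by (simp add: reachable_refl)
  next
    case (Suc i)
    then have "(i, Suc i) \<in> parcs (cycle_graph n)" by (simp add: cycle_graph_def)
    moreover have "0 \<rightarrow>\<^sup>*\<^bsub>with_proj (cycle_graph n)\<^esub> i" using Suc by simp
    ultimately show ?case by (simp add: reachable_adj_trans)
  qed
  have "connected (with_proj (cycle_graph n))"
  proof (rule connectedI)
    show "pverts (cycle_graph n) \<noteq> {}" using vs assms by simp
  next
    fix u v
    assume "u \<in> pverts (cycle_graph n)" "v \<in> pverts (cycle_graph n)"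
    then have "0 \<rightarrow>\<^sup>*\<^bsub>with_proj (cycle_graph n)\<^esub> u" "0 \<rightarrow>\<^sup>*\<^bsub>with_proj (cycle_graph n)\<^esub> v"
      using vs from0 by simp_all
    then have "u \<rightarrow>\<^sup>*\<^bsub>with_proj (cycle_graph n)\<^esub> v"
      by (blast intro: reachable_trans symmetric_reachable')
    then show "u \<rightarrow>\<^sup>*\<^bsub>with_proj (mk_symmetric (with_proj (cycle_graph n)))\<^esub> v"
      using reachable_mk_symmetric_eq[OF sym_arcs] by blast
  qed
  then show ?thesis by unfold_locales
qed

end

theory Submission
  imports Defs
begin

text \<open>
  Two vertices at distance \<open>w + 1\<close> on the cycle are joined by arcs with \<open>w\<close> and \<open>n - w - 2\<close> inner
  vertices. If \<open>n - w - 2 > k\<close>, a rainbow path under \<open>k\<close> colors must use the short arc, so any \<open>w\<close>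
  consecutive vertices have distinct colors, every color class has at most \<open>n div w\<close> vertices, and
  \<open>n \<le> k * (n div w)\<close>. With \<open>w\<close> about \<open>n / 2 - 2\<close> this gives all the lower bounds except for
  \<open>n \<le> 6\<close> and \<open>n \<in> {8, 9, 10}\<close>, where an exhaustive search over the colorings with distinct colors in
  all windows of length \<open>w\<close> finds two vertices with equal codes. For \<open>n \<ge> 8\<close> and \<open>k = \<lceil>n / 2\<rceil>\<close> the
  coloring \<open>1, 2, \<dots>, k, 2, 1, 3, \<dots>, k\<close> (cut after \<open>n\<close> terms) is locating: without the swap of the
  colors 1 and 2 it would, for even \<open>n\<close>, be invariant under the half turn. The remaining cases have
  sporadic colorings.
\<close>

section \<open>Distances and rainbow paths on the cycle\<close>

text \<open>The sum of the two truncated differences is \<open>\<bar>u - v\<bar>\<close>.\<close>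
definition cdist :: "nat \<Rightarrow> nat \<Rightarrow> nat \<Rightarrow> nat" where
  "cdist n u v = (let d = (u - v) + (v - u) in min d (n - d))"

text \<open>Finite quantifiers range over lists so that \<open>code_simp\<close> can decide concrete instances.\<close>
definition arc_rainbow :: "nat \<Rightarrow> (nat \<Rightarrow> nat) \<Rightarrow> nat \<Rightarrow> nat \<Rightarrow> nat \<Rightarrow> bool" where
  "arc_rainbow n c i a b \<longleftrightarrow> distinct (map (\<lambda>r. c ((i + r) mod n)) [a..<b])"

text \<open>The pair is given as \<open>i\<close> and \<open>i + d\<close> modulo \<open>n\<close>.
  Its two arcs have the inner offsets \<open>1, ..., d - 1\<close> and
  \<open>d + 1, ..., n - 1\<close>, and one of them has to be rainbow.\<close>

definition cyc_rainbow :: "nat \<Rightarrow> (nat \<Rightarrow> nat) \<Rightarrow> bool" where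
  "cyc_rainbow n c \<longleftrightarrow>
     (\<forall>i \<in> set [0..<n]. \<forall>d \<in> set [1..<n]. arc_rainbow n c i 1 d \<or> arc_rainbow n c i (Suc d) n)"

definition class_list :: "nat \<Rightarrow> (nat \<Rightarrow> nat) \<Rightarrow> nat \<Rightarrow> nat list" where
  "class_list n c i = filter (\<lambda>w. c w = i) [0..<n]"

definition cyc_code :: "nat \<Rightarrow> nat \<Rightarrow> (nat \<Rightarrow> nat) \<Rightarrow> nat \<Rightarrow> nat list" where
  "cyc_code n k c v = map (\<lambda>i. Min (set (map (cdist n v) (class_list n c i)))) [1..<k + 1]"

definition cyc_locating :: "nat \<Rightarrow> nat \<Rightarrow> (nat \<Rightarrow> nat) \<Rightarrow> bool" where
  "cyc_locating n k c \<longleftrightarrow>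
     (\<forall>v \<in> set [0..<n]. 1 \<le> c v \<and> c v \<le> k) \<and>
     (\<forall>i \<in> set [1..<k + 1]. class_list n c i \<noteq> []) \<and>
     cyc_rainbow n c \<and>
     distinct (map (cyc_code n k c) [0..<n])"

section \<open>Walks and distances on the cycle\<close>

lemma (in pair_wf_digraph) seq_awalk:
  assumes "f 0 \<in> pverts G" and "\<And>r. r < k \<Longrightarrow> (f r, f (Suc r)) \<in> parcs G"
  defines "p \<equiv> map (\<lambda>r. (f r, f (Suc r))) [0..<k]"
  shows "awalk (f 0) p (f k)" and "awalk_verts (f 0) p = map f [0..<Suc k]"
proof -
  have "awalk (f 0) p (f k) \<and> awalk_verts (f 0) p = map f [0..<Suc k]"
    using assms(2) unfolding p_def
  proof (induction k)
    case 0
    then show ?case using assms(1) by (simp add: awalk_Nil_iff)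
  next
    case (Suc k)
    let ?q = "map (\<lambda>r. (f r, f (Suc r))) [0..<k]"
    have IH: "awalk (f 0) ?q (f k)" "awalk_verts (f 0) ?q = map f [0..<Suc k]"
      using Suc by simp_all
    have e: "awalk (f k) [(f k, f (Suc k))] (f (Suc k))"
      using Suc.prems[of k] in_arcsD2[of "f k" "f (Suc k)"] by (simp add: awalk_simps)
    have "awalk (f 0) (?q @ [(f k, f (Suc k))]) (f (Suc k))"
      using IH(1) e by (rule awalk_appendI)
    moreover from this have "awalk_verts (f 0) (?q @ [(f k, f (Suc k))]) = map f [0..<Suc (Suc k)]"
      using IH by (simp add: awalk_verts_append)
    ultimately show ?case by simp
  qed
  then show "awalk (f 0) p (f k)" "awalk_verts (f 0) p = map f [0..<Suc k]" by auto
qed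

locale cycle =
  fixes n :: nat
  assumes n3: "n \<ge> 3"

sublocale cycle \<subseteq> connected_pair_graph "cycle_graph n"
  using n3 by (rule connected_pair_graph_cycle_graph)

context cycle
begin

lemma pverts_cycle: "pverts (cycle_graph n) = {0..<n}"
  by (simp add: cycle_graph_def)

lemma parcs_cycle_iff:
  "(i, j) \<in> parcs (cycle_graph n) \<longleftrightarrow> i < n \<and> j < n \<and> (j = (i + 1) mod n \<or> i = (j + 1) mod n)"
  by (simp add: cycle_graph_def)

lemma arc_forward: "((i + r) mod n, (i + Suc r) mod n) \<in> parcs (cycle_graph n)"
  using n3 by (simp add: parcs_cycle_iff mod_Suc_eq)

text \<open>The Lipschitz property that, by induction along a walk, makes \<open>cdist\<close> a
  lower bound for walk lengths. The cases are the two directions of an arc, with and without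
  wrapping around at 0.\<close>

lemma arc_cdist_le:
  assumes "(u, v) \<in> parcs (cycle_graph n)" "y < n"
  shows "cdist n u y \<le> cdist n v y + 1"
proof -
  have uv: "u < n" "v < n" using assms(1) by (simp_all add: parcs_cycle_iff)
  consider "v = Suc u" | "u = Suc v" | "v = 0" "u = n - 1" | "u = 0" "v = n - 1"
    using assms(1) by (auto simp: parcs_cycle_iff mod_Suc split: if_splits)
  then show ?thesis
    by cases (use uv assms(2) in \<open>simp add: cdist_def Let_def; arith\<close>)+
qed

lemma cdist_le_length:
  assumes "awalk u p v"
  shows "cdist n u v \<le> length p"
  using assms
proof (induction p arbitrary: u)
  case Nil
  then show ?case by (simp add: awalk_Nil_iff cdist_def)
next
  case (Cons e p)
  obtain a b where e: "e = (a, b)" by (cases e)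
  have "awalk b p v" "(u, b) \<in> parcs (cycle_graph n)"
    using Cons.prems e by (auto simp: awalk_Cons_iff)
  moreover have "v < n" using Cons.prems awalk_last_in_verts pverts_cycle by force
  ultimately show ?case using Cons.IH[of b] arc_cdist_le[of u b v] by simp
qed

lemma forward_awalk:
  assumes "i < n"
  shows "awalk i (map (\<lambda>r. ((i + r) mod n, (i + Suc r) mod n)) [0..<k]) ((i + k) mod n)"
    and "awalk_verts i (map (\<lambda>r. ((i + r) mod n, (i + Suc r) mod n)) [0..<k])
      = map (\<lambda>r. (i + r) mod n) [0..<Suc k]"
proof -
  have i: "(i + 0) mod n = i" using assms by simp
  have "(i + 0) mod n \<in> pverts (cycle_graph n)" using assms by (simp add: pverts_cycle)
  note seq = seq_awalk[of "\<lambda>r. (i + r) mod n", OF this arc_forward, unfolded i]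
  show "awalk i (map (\<lambda>r. ((i + r) mod n, (i + Suc r) mod n)) [0..<k]) ((i + k) mod n)"
    by (rule seq)
  show "awalk_verts i (map (\<lambda>r. ((i + r) mod n, (i + Suc r) mod n)) [0..<k])
      = map (\<lambda>r. (i + r) mod n) [0..<Suc k]"
    by (rule seq)
qed

text \<open>\<open>cdist\<close> is the smaller of the lengths of the two arcs. One arc is a forward
  walk from \<open>u\<close>, the other a reversed forward walk from \<open>v\<close>.\<close>

lemma awalk_cdist:
  assumes "u < n" "v < n"
  shows "\<exists>p. awalk u p v \<and> length p = cdist n u v"
proof -
  have fwd: "\<exists>p. awalk i p ((i + k) mod n) \<and> length p = k" if "i < n" for i k
    using forward_awalk(1)[OF that, of k] by (intro exI conjI) auto
  have bwd: "\<exists>p. awalk ((i + k) mod n) p i \<and> length p = k" if i: "i < n" for i k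
  proof -
    obtain p where p: "awalk i p ((i + k) mod n)" "length p = k" using fwd[OF i] by blast
    have "length (rev_path q) = length q" for q :: "(nat \<times> nat) list" by (induction q) auto
    then show ?thesis using p by (intro exI[of _ "rev_path p"]) simp
  qed
  show ?thesis
  proof (cases "u \<le> v")
    case True
    have "(v + (n - (v - u))) mod n = u"
    proof -
      have "v + (n - (v - u)) = u + n" using True assms by simp
      then show ?thesis using assms by simp
    qed
    moreover have "cdist n u v = min (v - u) (n - (v - u))" using True by (simp add: cdist_def)
    ultimately show ?thesis
      using fwd[OF assms(1), of "v - u"] bwd[OF assms(2), of "n - (v - u)"] True assms
      by (simp add: min_def)
  next
    case False
    have "(u + (n - (u - v))) mod n = v"
    proof -
      have "u + (n - (u - v)) = v + n" using False assms by simp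
      then show ?thesis using assms by simp
    qed
    moreover have "cdist n u v = min (u - v) (n - (u - v))" using False by (simp add: cdist_def)
    ultimately show ?thesis
      using fwd[OF assms(1), of "n - (u - v)"] bwd[OF assms(2), of "u - v"] False assms
      by (simp add: min_def)
  qed
qed

lemma gdist_cycle:
  assumes "u < n" "v < n"
  shows "gdist u v = ereal (real (cdist n u v))"
proof (rule antisym)
  have cost: "awalk_cost (\<lambda>_. 1) p = real (length p)" for p :: "(nat \<times> nat) list"
    by (induction p) auto
  obtain p where "awalk u p v" "length p = cdist n u v" using awalk_cdist[OF assms] by blast
  then show "gdist u v \<le> ereal (real (cdist n u v))"
    unfolding gdist_def using min_cost_le_walk_cost[of u p v "\<lambda>_. 1"] cost by simp
  show "ereal (real (cdist n u v)) \<le> gdist u v"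
    unfolding gdist_def \<mu>_def using cost cdist_le_length by (auto intro!: INF_greatest)
qed

text \<open>Deleting one vertex from each of the two open arcs between \<open>i\<close> and \<open>i + d\<close> disconnects
  them, so a path between them runs through all of one arc.\<close>
lemma awalk_covers_arc:
  assumes "awalk i p ((i + d) mod n)" and "i < n" "0 < d" "d < n"
  shows "(\<lambda>r. (i + r) mod n) ` {1..<d} \<subseteq> set (awalk_verts i p) \<or>
         (\<lambda>r. (i + r) mod n) ` {Suc d..<n} \<subseteq> set (awalk_verts i p)"
proof (rule ccontr)
  let ?v = "\<lambda>r. (i + r) mod n"
  assume "\<not> ?thesis"
  then obtain s t where "s \<in> {1..<d}" "t \<in> {Suc d..<n}"
    and "?v s \<notin> set (awalk_verts i p)" "?v t \<notin> set (awalk_verts i p)"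
    by blast
  then have s: "0 < s" "s < d" "?v s \<notin> set (awalk_verts i p)"
    and t: "d < t" "t < n" "?v t \<notin> set (awalk_verts i p)"
    by simp_all
  \<comment> \<open>\<open>S\<close> consists of the offsets of the component of \<open>i\<close>
    once the vertices at offsets \<open>s\<close> and \<open>t\<close> are deleted. By
    \<open>step\<close>, no arc to a remaining vertex leaves it, whereas \<open>d\<close> lies
    outside.\<close>
  define S where "S = {r. r < s \<or> t < r \<and> r < n}"
  have inj: "r = r'" if "?v r = ?v r'" "r < n" "r' < n" for r r'
    using that assms(2) by (auto simp: mod_if split: if_splits)
  have step: "v' \<in> ?v ` S"
    if st: "v \<in> ?v ` S" "(v, v') \<in> parcs (cycle_graph n)" "v' \<noteq> ?v s" "v' \<noteq> ?v t" for v v'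
  proof -
    obtain r where r: "r \<in> S" "v = ?v r" using st(1) by blast
    then have "r < n" using s t by (auto simp: S_def)
    consider "v' = ?v (Suc r)" | "v = (v' + 1) mod n" "v' < n"
      using st(2) r by (auto simp: parcs_cycle_iff mod_Suc_eq)
    then show ?thesis
    proof cases
      case 1
      show ?thesis
      proof (cases "Suc r = n")
        case True
        then have "v' = ?v 0" using 1 by simp
        moreover have "0 \<in> S" using s by (simp add: S_def)
        ultimately show ?thesis by blast
      next
        case False
        have "Suc r \<noteq> s" "Suc r \<noteq> t" using 1 st by auto
        then have "Suc r \<in> S" using r False \<open>r < n\<close> by (auto simp: S_def)
        then show ?thesis using 1 by blast
      qed
    next
      case 2
      define r' where "r' = (if r = 0 then n - 1 else r - 1)"
      have "?v (Suc r') = ?v r" using \<open>r < n\<close> by (auto simp: r'_def)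
      then have "(?v r' + 1) mod n = (v' + 1) mod n" using 2 r by (simp add: mod_Suc_eq)
      moreover have "?v r' < n" using \<open>r < n\<close> by simp
      ultimately have v': "v' = ?v r'"
        using 2(2) by (metis Suc_eq_plus1 mod_Suc nat.inject old.nat.distinct(1) mod_less)
      then have "r' \<noteq> s" "r' \<noteq> t" using st by auto
      then have "r' \<in> S" using r t \<open>r < n\<close> by (auto simp: S_def r'_def split: if_splits)
      then show ?thesis using v' by blast
    qed
  qed
  have "v \<in> ?v ` S" if "awalk u q v" "u \<in> ?v ` S" "set (awalk_verts u q) \<subseteq> set (awalk_verts i p)"
    for u v q
    using that
  proof (induction q arbitrary: u)
    case Nil
    then show ?case by (simp add: awalk_Nil_iff)
  next
    case (Cons e q)
    obtain a b where e: "e = (a, b)" by (cases e)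
    have w: "awalk b q v" "(u, b) \<in> parcs (cycle_graph n)"
      "set (awalk_verts b q) \<subseteq> set (awalk_verts i p)"
      using Cons.prems e by (auto simp: awalk_Cons_iff)
    then have "b \<in> set (awalk_verts i p)" using hd_in_awalk_verts(1) by blast
    then have "b \<in> ?v ` S" using step[OF Cons.prems(2) w(2)] s t by blast
    then show ?case using Cons.IH w by blast
  qed
  moreover have "i \<in> ?v ` S" using assms(2) s by (auto simp: S_def intro!: image_eqI[of _ _ 0])
  ultimately have "?v d \<in> ?v ` S" using assms(1) by blast
  then obtain r where r: "r \<in> S" "?v d = ?v r" by blast
  then have "d = r" using inj[of d r] s t assms(4) by (auto simp: S_def)
  then show False using r(1) s t by (simp add: S_def)
qed

section \<open>Rainbow paths between two vertices\<close>

lemma forward_apath: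
  assumes "i < n" "0 < d" "d < n"
  shows "\<exists>p. apath i p ((i + d) mod n) \<and> inner_verts p = map (\<lambda>r. (i + r) mod n) [1..<d]"
proof -
  let ?p = "map (\<lambda>r. ((i + r) mod n, (i + Suc r) mod n)) [0..<d]"
  have "inj_on (\<lambda>r. (i + r) mod n) {0..<Suc d}"
    using assms by (auto simp: inj_on_def mod_if split: if_splits)
  then have "apath i ?p ((i + d) mod n)"
    using forward_awalk[OF assms(1), of d] by (simp add: apath_def distinct_map del: upt_Suc)
  moreover have "inner_verts ?p = map (\<lambda>r. (i + r) mod n) [1..<d]"
    by (simp add: inner_verts_with_proj_def map_tl[symmetric] comp_def)
  ultimately show ?thesis by blast
qed

text \<open>Lets the second arc at \<open>i\<close> be read as a forward arc of length
  \<open>n - d\<close> from \<open>i + d\<close> back to \<open>i\<close>, so that the reversal of a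
  forward path serves for it.\<close>

lemma forward_shift:
  assumes "i < n" "0 < d" "d < n"
  shows "((i + d) mod n + (n - d)) mod n = i"
    and "map (\<lambda>r. ((i + d) mod n + r) mod n) [1..<n - d] = map (\<lambda>r. (i + r) mod n) [Suc d..<n]"
proof -
  show "((i + d) mod n + (n - d)) mod n = i"
    using assms mod_add_left_eq[of "i + d" n "n - d"] by simp
  have "[Suc d..<n] = map (\<lambda>r. d + r) [1..<n - d]"
    using assms by (intro nth_equalityI) auto
  then show "map (\<lambda>r. ((i + d) mod n + r) mod n) [1..<n - d] = map (\<lambda>r. (i + r) mod n) [Suc d..<n]"
    by (simp add: comp_def mod_add_left_eq add.assoc)
qed

text \<open>By \<open>awalk_covers_arc\<close>, a path contains the interior of one arc, which
  inherits distinct colors from the path. Conversely, each arc is itself a path.\<close>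

lemma rainbow_vertex_path_iff:
  assumes "i < n" "0 < d" "d < n"
  shows "(\<exists>p. rainbow_vertex_path c i p ((i + d) mod n)) \<longleftrightarrow>
    arc_rainbow n c i 1 d \<or> arc_rainbow n c i (Suc d) n"
proof
  assume "\<exists>p. rainbow_vertex_path c i p ((i + d) mod n)"
  then obtain p where p: "apath i p ((i + d) mod n)" "distinct (map c (inner_verts p))"
    by (auto simp: rainbow_vertex_path_def)
  let ?v = "\<lambda>r. (i + r) mod n"
  have inj: "inj_on ?v {0..<n}"
    using assms by (auto simp: inj_on_def mod_if split: if_splits)
  have "i = ?v 0" using assms by simp
  then have ends: "?v r \<noteq> i" "?v r \<noteq> ?v d" if "r \<noteq> 0" "r \<noteq> d" "r < n" for r
    using inj_onD[OF inj, of r 0] inj_onD[OF inj, of r d] that assms by force+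
  have inner: "set (inner_verts p) = set (awalk_verts i p) - {i, ?v d}"
    using p(1) by (rule set_inner_verts)
  \<comment> \<open>The conditions on \<open>a\<close> and \<open>b\<close> keep the offsets
    \<open>0\<close> and \<open>d\<close> out of the stretch, so all its vertices are inner vertices
    of \<open>p\<close>.\<close>
  have rainbow: "arc_rainbow n c i a b"
    if ab: "?v ` {a..<b} \<subseteq> set (awalk_verts i p)" "0 < a" "b \<le> n" "d < a \<or> b \<le> d" for a b
  proof -
    have "?v ` {a..<b} \<subseteq> set (inner_verts p)"
      using ab ends unfolding inner by fastforce
    then have "inj_on c (?v ` {a..<b})"
      using p(2) by (metis distinct_map inj_on_subset)
    moreover have "inj_on ?v {a..<b}"
      by (rule inj_on_subset[OF inj]) (use ab(3) in auto)
    ultimately have "inj_on (c \<circ> ?v) {a..<b}" by (simp add: comp_inj_on)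
    then show ?thesis by (simp add: arc_rainbow_def distinct_map comp_def)
  qed
  have "awalk i p (?v d)" using p(1) by (rule awalkI_apath)
  from awalk_covers_arc[OF this assms] show "arc_rainbow n c i 1 d \<or> arc_rainbow n c i (Suc d) n"
    using rainbow[of 1 d] rainbow[of "Suc d" n] assms by auto
next
  assume "arc_rainbow n c i 1 d \<or> arc_rainbow n c i (Suc d) n"
  then show "\<exists>p. rainbow_vertex_path c i p ((i + d) mod n)"
  proof
    assume "arc_rainbow n c i 1 d"
    then show ?thesis
      using forward_apath[OF assms]
      by (force simp: rainbow_vertex_path_def arc_rainbow_def comp_def)
  next
    assume rb: "arc_rainbow n c i (Suc d) n"
    obtain p where p: "apath ((i + d) mod n) p i"
      "inner_verts p = map (\<lambda>r. (i + r) mod n) [Suc d..<n]"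
      using forward_apath[of "(i + d) mod n" "n - d", unfolded forward_shift[OF assms]] assms
      by auto
    have "apath i (rev_path p) ((i + d) mod n)" using p(1) by simp
    moreover have "distinct (map c (inner_verts (rev_path p)))"
      using rb p inner_verts_rev_path[OF awalkI_apath[OF p(1)]]
      by (simp add: arc_rainbow_def comp_def rev_map[symmetric])
    ultimately show ?thesis unfolding rainbow_vertex_path_def by blast
  qed
qed

section \<open>Reduction from the graph to arithmetic modulo the order\<close>

lemma rainbow_vertex_coloring_iff:
  "rainbow_vertex_coloring k c \<longleftrightarrow> (\<forall>v < n. 1 \<le> c v \<and> c v \<le> k) \<and> cyc_rainbow n c"
proof -
  have "(\<forall>x \<in> {0..<n}. \<forall>y \<in> {0..<n}. x \<noteq> y \<longrightarrow> (\<exists>p. rainbow_vertex_path c x p y)) \<longleftrightarrow>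
    (\<forall>i \<in> {0..<n}. \<forall>d \<in> {1..<n}. \<exists>p. rainbow_vertex_path c i p ((i + d) mod n))" (is "?L \<longleftrightarrow> ?R")
  proof
    assume L: ?L
    have "(i + d) mod n \<noteq> i" if "i < n" "0 < d" "d < n" for i d
      using that by (auto simp: mod_if)
    moreover have "(i + d) mod n \<in> {0..<n}" for i d using n3 by simp
    ultimately show ?R using L by (metis atLeastLessThan_iff less_eq_Suc_le One_nat_def)
  next
    assume R: ?R
    show ?L
    proof (intro ballI impI)
      fix x y assume xy: "x \<in> {0..<n}" "y \<in> {0..<n}" "x \<noteq> y"
      define d where "d = (if x < y then y - x else n - (x - y))"
      have "d \<in> {1..<n}" "(x + d) mod n = y"
        using xy by (auto simp: d_def mod_if)
      then show "\<exists>p. rainbow_vertex_path c x p y" using R xy(1) by metis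
    qed
  qed
  then show ?thesis
    unfolding rainbow_vertex_coloring_def cyc_rainbow_def pverts_cycle
    by (auto simp: rainbow_vertex_path_iff Pi_iff)
qed

lemma set_gdist_class:
  assumes "v < n" "class_list n c i \<noteq> []"
  shows "set_gdist v (color_class c i) = ereal (real (Min (set (map (cdist n v) (class_list n c i)))))"
proof -
  have cl: "color_class c i = set (class_list n c i)"
    by (auto simp: color_class_def class_list_def pverts_cycle)
  have "gdist v ` set (class_list n c i) = (\<lambda>d. ereal (real d)) ` set (map (cdist n v) (class_list n c i))"
    using gdist_cycle[OF assms(1)] by (force simp: class_list_def)
  then show ?thesis
    unfolding set_gdist_def cl using assms(2)
    by (simp add: mono_def flip: mono_Min_commute)
qed

lemma rainbow_code_cycle:
  assumes "v < n" "\<forall>i \<in> {1..k}. class_list n c i \<noteq> []"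
  shows "rainbow_code k c v = map (\<lambda>d. ereal (real d)) (cyc_code n k c v)"
  using assms by (auto simp: rainbow_code_def cyc_code_def set_gdist_class)

text \<open>From here on neither paths nor extended reals occur, and a concrete instance can be
  decided by evaluation.\<close>

lemma locating_rainbow_coloring_iff:
  "locating_rainbow_coloring k c \<longleftrightarrow> cyc_locating n k c"
proof -
  have cl: "(\<forall>i \<in> {1..k}. color_class c i \<noteq> {}) \<longleftrightarrow> (\<forall>i \<in> {1..k}. class_list n c i \<noteq> [])"
    by (auto simp: color_class_def class_list_def pverts_cycle filter_empty_conv Bex_def)
  have "(\<forall>u \<in> {0..<n}. \<forall>v \<in> {0..<n}. u \<noteq> v \<longrightarrow> rainbow_code k c u \<noteq> rainbow_code k c v) \<longleftrightarrow>
    distinct (map (cyc_code n k c) [0..<n])" if "\<forall>i \<in> {1..k}. class_list n c i \<noteq> []"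
  proof -
    have "inj (\<lambda>d. ereal (real d))" by (simp add: inj_def)
    then have "rainbow_code k c u = rainbow_code k c v \<longleftrightarrow> cyc_code n k c u = cyc_code n k c v"
      if "u < n" "v < n" for u v
      using rainbow_code_cycle \<open>\<forall>i \<in> {1..k}. class_list n c i \<noteq> []\<close> that by (simp add: inj_map_eq_map)
    then show ?thesis by (auto simp: distinct_map inj_on_def)
  qed
  moreover have "set [1..<k + 1] = {1..k}" by auto
  ultimately show ?thesis
    unfolding locating_rainbow_coloring_def rainbow_vertex_coloring_iff cl cyc_locating_def pverts_cycle
    by (auto simp del: upt_Suc)
qed

lemma rvcl_eqI:
  assumes "cyc_locating n k c" "1 \<le> k" "\<And>j c. 1 \<le> j \<Longrightarrow> j < k \<Longrightarrow> \<not> cyc_locating n j c"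
  shows "rvcl = k"
  unfolding rvcl_def locating_rainbow_coloring_iff
  by (rule Least_equality) (use assms in \<open>auto simp: not_less[symmetric]\<close>)

end

section \<open>Criteria for rainbow colorings and for equal codes\<close>

lemma arc_rainbow_iff_inj:
  "arc_rainbow n c i a b \<longleftrightarrow> inj_on (\<lambda>r. c ((i + r) mod n)) {a..<b}"
  by (simp add: arc_rainbow_def distinct_map)

lemma cdist_shift_le:
  assumes "r < r'" "r' - r < n"
  shows "(i + r) mod n \<noteq> (i + r') mod n" and "cdist n ((i + r) mod n) ((i + r') mod n) \<le> r' - r"
proof -
  define u where "u = (i + r) mod n"
  define e where "e = r' - r"
  have e: "0 < e" "e < n" using assms by (simp_all add: e_def)
  then have u: "u < n" by (simp add: u_def)
  have "(i + r') mod n = (u + e) mod n"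
    using assms mod_add_left_eq[of "i + r" n "r' - r"] by (simp add: u_def e_def)
  also have "\<dots> = (if u + e < n then u + e else u + e - n)"
    using u e by (simp add: mod_if)
  finally have v: "(i + r') mod n = (if u + e < n then u + e else u + e - n)" .
  have "u \<noteq> (i + r') mod n \<and> cdist n u ((i + r') mod n) \<le> e"
  proof (cases "u + e < n")
    case True
    then show ?thesis using e unfolding v by (simp add: cdist_def)
  next
    case False
    define w where "w = u + e - n"
    have "u = w + (n - e)" using False e by (simp add: w_def)
    then show ?thesis using False e unfolding v w_def[symmetric] by (simp add: cdist_def)
  qed
  then show "(i + r) mod n \<noteq> (i + r') mod n" "cdist n ((i + r) mod n) ((i + r') mod n) \<le> r' - r"
    by (simp_all add: u_def e_def)
qed

lemma cdist_commute: "cdist n u v = cdist n v u"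
  by (simp add: cdist_def add.commute)

text \<open>Offsets in the stretch differ by less than \<open>b - a\<close>, hence by less than
  \<open>L\<close>, so two vertices of one color would be too close.\<close>

lemma arc_rainbowI:
  assumes "\<And>u v. u < v \<Longrightarrow> v < n \<Longrightarrow> c u = c v \<Longrightarrow> L \<le> cdist n u v"
    and "0 < n" "b - a \<le> L" "L < n"
  shows "arc_rainbow n c i a b"
proof -
  have "c ((i + r) mod n) \<noteq> c ((i + r') mod n)" if r: "a \<le> r" "r < r'" "r' < b" for r r'
  proof
    assume eq: "c ((i + r) mod n) = c ((i + r') mod n)"
    let ?u = "(i + r) mod n" and ?v = "(i + r') mod n"
    have "?u \<noteq> ?v" "cdist n ?u ?v \<le> r' - r"
      using cdist_shift_le[of r r' n i] r assms by simp_all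
    moreover have "?u < n" "?v < n" using assms(2) by simp_all
    ultimately have "L \<le> r' - r"
      using assms(1)[of ?u ?v] assms(1)[of ?v ?u] eq cdist_commute[of n ?u ?v]
      by (cases "?u < ?v") auto
    then show False using r assms(3) by simp
  qed
  then have "inj_on (\<lambda>r. c ((i + r) mod n)) {a..<b}"
    by (intro linorder_inj_onI) auto
  then show ?thesis by (simp add: arc_rainbow_def distinct_map)
qed

text \<open>The two arcs between a pair have \<open>n - 2\<close> inner vertices together, so one of
  them has at most \<open>(n - 2) div 2\<close>.\<close>

lemma cyc_rainbowI:
  assumes "\<And>u v. u < v \<Longrightarrow> v < n \<Longrightarrow> c u = c v \<Longrightarrow> (n - 2) div 2 \<le> cdist n u v"
  shows "cyc_rainbow n c"
  unfolding cyc_rainbow_def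
proof (intro ballI)
  fix i d assume i: "i \<in> set [0..<n]" and d: "d \<in> set [1..<n]"
  let ?L = "(n - 2) div 2"
  have rainbow: "arc_rainbow n c i a b" if "b - a \<le> ?L" for a b
    by (rule arc_rainbowI[of n c ?L]) (use assms that i in auto)
  have "d - 1 \<le> ?L \<or> n - Suc d \<le> ?L" using d by auto
  then show "arc_rainbow n c i 1 d \<or> arc_rainbow n c i (Suc d) n"
    using rainbow by blast
qed

text \<open>The entry for the color of \<open>u\<close> is 0 at \<open>u\<close>, hence also at
  \<open>v\<close>, which puts \<open>v\<close> into the same class. Codes thus need to be compared
  only within color classes.\<close>

lemma cyc_code_eq_imp_color_eq:
  assumes "cyc_code n k c u = cyc_code n k c v" "u < n" "v < n" "1 \<le> c u" "c u \<le> k"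
  shows "c u = c v"
proof -
  let ?D = "\<lambda>w. Min (set (map (cdist n w) (class_list n c (c u))))"
  have mem: "u \<in> set (class_list n c (c u))" using assms by (simp add: class_list_def)
  have "?D u = ?D v" using assms by (auto simp: cyc_code_def)
  moreover have "?D u = 0"
    using mem by (auto intro!: Min_eqI image_eqI[of _ _ u] simp: cdist_def)
  moreover have "?D v \<in> cdist n v ` set (class_list n c (c u))"
    using mem Min_in[of "cdist n v ` set (class_list n c (c u))"] by fastforce
  ultimately obtain w where "w \<in> set (class_list n c (c u))" "cdist n v w = 0" by auto
  then show ?thesis using assms(3)
    by (auto simp: class_list_def cdist_def Let_def min_def split: if_splits)
qed

section \<open>Lower bounds\<close>

lemma window_rainbow:
  assumes "\<forall>v < n. 1 \<le> c v \<and> c v \<le> k" "cyc_rainbow n c" "k + w + 2 < n" "i < n"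
  shows "arc_rainbow n c i 1 (Suc w)"
proof -
  \<comment> \<open>For the pair \<open>i\<close>, \<open>i + Suc w\<close> this arc has
    \<open>n - w - 2 > k\<close> inner vertices, too many for \<open>k\<close> colors.\<close>
  have "\<not> arc_rainbow n c i (Suc (Suc w)) n"
  proof
    assume "arc_rainbow n c i (Suc (Suc w)) n"
    then have "card ((\<lambda>r. c ((i + r) mod n)) ` {Suc (Suc w)..<n}) = n - Suc (Suc w)"
      by (simp add: arc_rainbow_def distinct_map card_image)
    moreover have "(\<lambda>r. c ((i + r) mod n)) ` {Suc (Suc w)..<n} \<subseteq> {1..k}"
      using assms by auto
    then have "card ((\<lambda>r. c ((i + r) mod n)) ` {Suc (Suc w)..<n}) \<le> k"
      using card_mono[of "{1..k}"] by fastforce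
    ultimately show False using assms(3) by simp
  qed
  moreover have "Suc w \<in> set [1..<n]" "i \<in> set [0..<n]" using assms by auto
  ultimately show ?thesis using assms(2) unfolding cyc_rainbow_def by blast
qed

text \<open>Double counting: every vertex lies in \<open>w\<close> of the \<open>n\<close> windows
  of length \<open>w\<close>, and every window contains at most one vertex of color
  \<open>a\<close>.\<close>

lemma card_class_le:
  assumes "\<And>i. i < n \<Longrightarrow> arc_rainbow n c i 1 (Suc w)" "w < n"
  shows "card {v \<in> {0..<n}. c v = a} * w \<le> n"
proof -
  let ?A = "{v \<in> {0..<n}. c v = a}"
  \<comment> \<open>\<open>?g\<close> returns the \<open>z\<close> whose window
    \<open>z + 1, ..., z + w\<close> has \<open>v\<close> at offset \<open>r\<close>;
    \<open>n - r\<close> stands for \<open>-r\<close> modulo \<open>n\<close>.\<close>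
  let ?g = "\<lambda>(v, r). (v + (n - r)) mod n"
  have recover: "(?g (v, r) + r) mod n = v" if "v < n" "r \<le> w" for v r
    using that assms(2) mod_add_left_eq[of "v + (n - r)" n r] by simp
  have "inj_on ?g (?A \<times> {1..w})"
  proof (rule inj_onI, clarify)
    fix v r v' r'
    assume v: "v \<in> {0..<n}" "v' \<in> {0..<n}" "c v' = c v" "a = c v"
      and r: "r \<in> {1..w}" "r' \<in> {1..w}"
      and eq: "(v + (n - r)) mod n = (v' + (n - r')) mod n"
    let ?z = "(v + (n - r)) mod n"
    have z: "(?z + r) mod n = v" "(?z + r') mod n = v'"
      using recover[of v r] recover[of v' r'] v r eq by auto
    have "inj_on (\<lambda>r. c ((?z + r) mod n)) {1..<Suc w}"
      using assms(1)[of ?z] v by (simp add: arc_rainbow_def distinct_map del: upt_Suc)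
    then have "r = r'" using z r v by (auto dest!: inj_onD[of _ _ r r'])
    then show "v = v' \<and> r = r'" using z by simp
  qed
  moreover have "?g ` (?A \<times> {1..w}) \<subseteq> {0..<n}" by auto
  ultimately have "card (?A \<times> {1..w}) \<le> card {0..<n}" by (rule card_inj_on_le) simp
  then show ?thesis by (simp add: card_cartesian_product)
qed

lemma order_le_if_rainbow:
  assumes "\<forall>v < n. 1 \<le> c v \<and> c v \<le> k" "cyc_rainbow n c" "k + w + 2 < n" "0 < w"
  shows "n \<le> k * (n div w)"
proof -
  let ?A = "\<lambda>a. {v \<in> {0..<n}. c v = a}"
  have "card (?A a) \<le> n div w" for a
    using card_class_le[of n c w a] window_rainbow[OF assms(1-3)] assms
    by (simp add: less_eq_div_iff_mult_less_eq)
  then have "(\<Sum>a \<in> {1..k}. card (?A a)) \<le> k * (n div w)"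
    using sum_bounded_above[of "{1..k}" "\<lambda>a. card (?A a)" "n div w"] by simp
  moreover have "card (\<Union>a \<in> {1..k}. ?A a) \<le> (\<Sum>a \<in> {1..k}. card (?A a))"
    by (rule card_UN_le) simp
  moreover have "(\<Union>a \<in> {1..k}. ?A a) = {0..<n}" using assms(1) by auto
  ultimately show ?thesis by simp
qed

section \<open>Renaming of colors and exhaustive search\<close>

lemma cyc_locating_permute:
  assumes "cyc_locating n k c" "bij_betw \<pi> {1..k} {1..k}"
  shows "cyc_locating n k (\<pi> \<circ> c)"
proof -
  have range: "c v \<in> {1..k}" if "v < n" for v
    using assms(1) that by (simp add: cyc_locating_def)
  have inj: "inj_on \<pi> {1..k}" and surj: "\<pi> ` {1..k} = {1..k}"
    using assms(2) by (auto simp: bij_betw_def)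
  have cl: "class_list n (\<pi> \<circ> c) (\<pi> i) = class_list n c i" if "i \<in> {1..k}" for i
    unfolding class_list_def
  proof (rule filter_cong[OF refl])
    fix v assume "v \<in> set [0..<n]"
    then show "((\<pi> \<circ> c) v = \<pi> i) = (c v = i)"
      using inj_on_eq_iff[OF inj range that] by simp
  qed
  have arc: "arc_rainbow n (\<pi> \<circ> c) i a b" if "arc_rainbow n c i a b" "i < n" for i a b
  proof -
    have "inj_on \<pi> ((\<lambda>r. c ((i + r) mod n)) ` {a..<b})"
      by (rule inj_on_subset[OF inj]) (use range that in auto)
    then show ?thesis
      using that(1) comp_inj_on[of "\<lambda>r. c ((i + r) mod n)" "{a..<b}" \<pi>]
      unfolding arc_rainbow_def distinct_map comp_def by simp
  qed
  have "arc_rainbow n (\<pi> \<circ> c) i 1 d \<or> arc_rainbow n (\<pi> \<circ> c) i (Suc d) n"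
    if "i \<in> set [0..<n]" "d \<in> set [1..<n]" for i d
  proof -
    have "arc_rainbow n c i 1 d \<or> arc_rainbow n c i (Suc d) n"
      using assms(1) that unfolding cyc_locating_def cyc_rainbow_def by blast
    moreover have "i < n" using that(1) by simp
    ultimately show ?thesis using arc by blast
  qed
  then have rainbow: "cyc_rainbow n (\<pi> \<circ> c)" unfolding cyc_rainbow_def by blast
  have set: "set [1..<k + 1] = {1..k}" by auto
  \<comment> \<open>Entry \<open>\<pi> i\<close> of a new code is entry \<open>i\<close> of the old
    one, so renaming merely permutes the entries.\<close>
  have code: "cyc_code n k c u = cyc_code n k c v"
    if "cyc_code n k (\<pi> \<circ> c) u = cyc_code n k (\<pi> \<circ> c) v" for u v
    unfolding cyc_code_def
  proof (rule map_cong[OF refl])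
    fix i assume "i \<in> set [1..<k + 1]"
    then have i: "i \<in> {1..k}" "\<pi> i \<in> set [1..<k + 1]" using surj unfolding set by auto
    have "Min (set (map (cdist n u) (class_list n (\<pi> \<circ> c) (\<pi> i)))) =
        Min (set (map (cdist n v) (class_list n (\<pi> \<circ> c) (\<pi> i))))"
      using that i(2) unfolding cyc_code_def map_eq_conv by blast
    then show "Min (set (map (cdist n u) (class_list n c i))) = Min (set (map (cdist n v) (class_list n c i)))"
      unfolding cl[OF i(1)] .
  qed
  have inj_code: "inj_on (cyc_code n k c) {0..<n}"
    using assms(1) unfolding cyc_locating_def distinct_map by simp
  have "inj_on (cyc_code n k (\<pi> \<circ> c)) {0..<n}"
    by (rule inj_onI) (rule inj_onD[OF inj_code code])
  then have distinct: "distinct (map (cyc_code n k (\<pi> \<circ> c)) [0..<n])"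
    unfolding distinct_map set_upt using distinct_upt by blast
  have nonempty: "class_list n (\<pi> \<circ> c) i \<noteq> []" if i: "i \<in> {1..k}" for i
  proof -
    obtain j where j: "j \<in> {1..k}" "i = \<pi> j" using surj i by blast
    have "class_list n c j \<noteq> []" using assms(1) j(1) unfolding cyc_locating_def set by blast
    then show ?thesis unfolding j(2) cl[OF j(1)] .
  qed
  have "1 \<le> (\<pi> \<circ> c) v \<and> (\<pi> \<circ> c) v \<le> k" if "v \<in> set [0..<n]" for v
  proof -
    have "\<pi> (c v) \<in> \<pi> ` {1..k}" using range[of v] that by simp
    then show ?thesis unfolding surj by simp
  qed
  then show ?thesis using rainbow distinct nonempty unfolding cyc_locating_def set by blast
qed

text \<open>The colors of the first \<open>w\<close> vertices are numbered by position. As many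
  colors remain in the domain as in the target, so any bijection between the remainders completes
  the permutation.\<close>

lemma ex_normalizing_permutation:
  fixes c :: "nat \<Rightarrow> nat"
  assumes "inj_on c {0..<w}" "c ` {0..<w} \<subseteq> {1..k}"
  shows "\<exists>\<pi>. bij_betw \<pi> {1..k} {1..k} \<and> (\<forall>i < w. \<pi> (c i) = i + 1)"
proof -
  let ?C = "c ` {0..<w}"
  have "card ?C = w" using assms(1) by (simp add: card_image)
  then have "w \<le> k" using card_mono[OF _ assms(2)] by simp
  have f: "bij_betw (Suc \<circ> the_inv_into {0..<w} c) ?C {1..w}"
  proof (rule bij_betw_trans)
    show "bij_betw (the_inv_into {0..<w} c) ?C {0..<w}"
      using assms(1) by (simp add: bij_betw_the_inv_into inj_on_imp_bij_betw)
    show "bij_betw Suc {0..<w} {1..w}" by (auto simp: bij_betw_def image_Suc_atLeastLessThan)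
  qed
  have "card ({1..k} - ?C) = card ({1..k} - {1..w})"
    using \<open>card ?C = w\<close> \<open>w \<le> k\<close> assms(2) by (simp add: card_Diff_subset)
  then obtain g where g: "bij_betw g ({1..k} - ?C) ({1..k} - {1..w})"
    using finite_same_card_bij by blast
  let ?\<pi> = "\<lambda>x. if x \<in> ?C then (Suc \<circ> the_inv_into {0..<w} c) x else g x"
  have "bij_betw ?\<pi> (?C \<union> ({1..k} - ?C)) ({1..w} \<union> ({1..k} - {1..w}))"
    using f g by (rule bij_betw_disjoint_Un) auto
  moreover have "?C \<union> ({1..k} - ?C) = {1..k}" "{1..w} \<union> ({1..k} - {1..w}) = {1..k}"
    using assms(2) \<open>w \<le> k\<close> by auto
  ultimately have "bij_betw ?\<pi> {1..k} {1..k}" by simp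
  moreover have "\<forall>i < w. ?\<pi> (c i) = i + 1" using the_inv_into_f_f[OF assms(1)] by simp
  ultimately show ?thesis by blast
qed

text \<open>The first \<open>w\<close> colors are pairwise distinct, so up to renaming they are \<open>1, \<dots>, w\<close>.\<close>
fun window_lists :: "nat \<Rightarrow> nat \<Rightarrow> nat \<Rightarrow> nat list list" where
  "window_lists w k 0 = [[]]"
| "window_lists w k (Suc m) = concat (map (\<lambda>p. map (\<lambda>x. p @ [x])
       (if m < w then [m + 1] else filter (\<lambda>x. x \<notin> set (drop (Suc m - w) p)) [1..<k + 1]))
     (window_lists w k m))"

text \<open>The lists respect only windows that do not wrap around, so they may include more than
  the rainbow candidates; for an exhaustive search, missing none is enough.\<close>

lemma window_lists_complete:
  assumes "\<forall>v < n. 1 \<le> c v \<and> c v \<le> k" "\<And>i. i < n \<Longrightarrow> arc_rainbow n c i 1 (Suc w)" "m \<le> n"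
    and "\<And>i. i < w \<Longrightarrow> c i = i + 1"
  shows "map c [0..<m] \<in> set (window_lists w k m)"
  using assms(3)
proof (induction m)
  case 0
  then show ?case by simp
next
  case (Suc m)
  have "c m \<noteq> c u" if u: "Suc m - w \<le> u" "u < m" for u
  proof -
    \<comment> \<open>\<open>?i\<close> is the predecessor of \<open>u\<close>, since window offsets
      start at 1. Its window has \<open>u\<close> at offset 1 and \<open>m\<close> at offset
      \<open>m - u + 1 \<le> w\<close>.\<close>
    let ?i = "(u + (n - 1)) mod n"
    have "?i < n" using Suc.prems by simp
    then have inj: "inj_on (\<lambda>r. c ((?i + r) mod n)) {1..<Suc w}"
      using assms(2)[of ?i] by (simp add: arc_rainbow_def distinct_map del: upt_Suc)
    have "(?i + 1) mod n = u" "(?i + (m - u + 1)) mod n = m"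
      using u Suc.prems mod_add_left_eq[of "u + (n - 1)" n 1]
        mod_add_left_eq[of "u + (n - 1)" n "m - u + 1"] by simp_all
    moreover have "m - u + 1 \<in> {1..<Suc w}" "1 \<in> {1..<Suc w}" "m - u + 1 \<noteq> 1" using u by auto
    ultimately show ?thesis using inj_onD[OF inj, of "m - u + 1" 1] by metis
  qed
  then have "c m \<notin> set (drop (Suc m - w) (map c [0..<m]))"
    unfolding drop_map drop_upt set_map set_upt by fastforce
  moreover have "c m \<in> set [1..<k + 1]"
    using assms(1)[rule_format, of m] Suc.prems by (simp del: upt_Suc)
  moreover have "map c [0..<m] \<in> set (window_lists w k m)" using Suc by simp
  ultimately have "map c [0..<m] @ [c m] \<in> set (window_lists w k (Suc m))"
    using assms(4)[of m] by (cases "m < w") (fastforce simp del: upt_Suc)+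
  then show ?case by simp
qed

lemma cyc_locating_cong:
  assumes "\<And>v. v < n \<Longrightarrow> c v = c' v"
  shows "cyc_locating n k c \<longleftrightarrow> cyc_locating n k c'"
proof -
  have "class_list n c = class_list n c'"
    using assms by (auto simp: class_list_def fun_eq_iff intro!: filter_cong)
  moreover have "arc_rainbow n c i a b \<longleftrightarrow> arc_rainbow n c' i a b" if "i < n" for i a b
    using assms that by (simp add: arc_rainbow_def)
  moreover have "cyc_code n k c = cyc_code n k c'"
    using calculation(1) by (simp add: fun_eq_iff cyc_code_def)
  ultimately show ?thesis
    using assms by (simp add: cyc_locating_def cyc_rainbow_def)
qed

text \<open>Doubling the list turns stretches that wrap around into contiguous ones.\<close>

lemma take_drop_cycle:
  assumes "i + b \<le> 2 * n" "a \<le> b"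
  shows "take (b - a) (drop (i + a) (map c [0..<n] @ map c [0..<n])) = map (\<lambda>r. c ((i + r) mod n)) [a..<b]"
    (is "take _ (drop _ ?p) = ?q")
proof (rule nth_equalityI)
  show "length (take (b - a) (drop (i + a) ?p)) = length ?q" using assms by simp
next
  have nth: "?p ! m = c (m mod n)" if "m < 2 * n" for m
    using that by (simp add: nth_append mod_if)
  fix j assume "j < length (take (b - a) (drop (i + a) ?p))"
  then have "j < b - a" "i + a + j < 2 * n" using assms by auto
  then show "take (b - a) (drop (i + a) ?p) ! j = ?q ! j"
    using assms nth[of "i + a + j"] by (simp add: add.assoc del: drop_append take_append)
qed

text \<open>Necessary for a rainbow coloring: only (nearly) antipodal pairs are tested, to prune the search.\<close>
definition half_rainbow :: "nat \<Rightarrow> nat list \<Rightarrow> bool" where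
  "half_rainbow n p \<longleftrightarrow> (let h = n div 2 in
     \<forall>i \<in> set [0..<h].
       distinct (take (h - 1) (drop (i + 1) (p @ p))) \<or>
       distinct (take (n - Suc h) (drop (i + Suc h) (p @ p))))"

lemma half_rainbow_if_cyc_rainbow:
  assumes "cyc_rainbow n c"
  shows "half_rainbow n (map c [0..<n])"
  unfolding half_rainbow_def Let_def
proof
  let ?h = "n div 2" and ?p = "map c [0..<n]"
  fix i assume i: "i \<in> set [0..<?h]"
  then have "i \<in> set [0..<n]" "?h \<in> set [1..<n]" by auto
  then have "arc_rainbow n c i 1 ?h \<or> arc_rainbow n c i (Suc ?h) n"
    using assms unfolding cyc_rainbow_def by blast
  moreover have "take (?h - 1) (drop (i + 1) (?p @ ?p)) = map (\<lambda>r. c ((i + r) mod n)) [1..<?h]"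
    using i by (intro take_drop_cycle) auto
  moreover have "take (n - Suc ?h) (drop (i + Suc ?h) (?p @ ?p)) =
      map (\<lambda>r. c ((i + r) mod n)) [Suc ?h..<n]"
    using i by (intro take_drop_cycle) auto
  ultimately show "distinct (take (?h - 1) (drop (i + 1) (?p @ ?p))) \<or>
      distinct (take (n - Suc ?h) (drop (i + Suc ?h) (?p @ ?p)))"
    unfolding arc_rainbow_def by argo
qed

definition search_fails :: "nat \<Rightarrow> nat \<Rightarrow> nat \<Rightarrow> bool" where
  "search_fails n k w \<longleftrightarrow>
     (\<forall>p \<in> set (filter (half_rainbow n) (window_lists w k n)). \<not> cyc_locating n k ((!) p))"

text \<open>A locating coloring, renamed to begin with \<open>1, ..., w\<close>, would be among the
  lists searched. The alternative \<open>w = 1\<close> is available for every \<open>n\<close>,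
  because windows of length one are rainbow under any coloring.\<close>

lemma not_cyc_locating_search:
  assumes "search_fails n k w" "k + w + 2 < n \<or> w = 1" "w < n"
  shows "\<not> cyc_locating n k c"
proof
  assume loc: "cyc_locating n k c"
  have windows: "arc_rainbow n c' i 1 (Suc w)" if "cyc_locating n k c'" "i < n" for c' i
    using assms(2)
  proof
    assume "k + w + 2 < n"
    then show ?thesis using window_rainbow[of n c' k w i] that by (simp add: cyc_locating_def)
  qed (simp add: arc_rainbow_def)
  have "inj_on c {0..<w}"
  proof -
    \<comment> \<open>The window with offsets \<open>1, ..., w\<close> from \<open>n - 1\<close>
      consists of the vertices \<open>0, ..., w - 1\<close>.\<close>
    let ?f = "\<lambda>r. c ((n - 1 + r) mod n)"
    have f: "?f (Suc x) = c x" if "x < w" for x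
    proof -
      have "n - 1 + Suc x = x + n" "x < n" using that assms(3) by auto
      then show ?thesis by (metis mod_add_self2 mod_less)
    qed
    have inj: "inj_on ?f {1..<Suc w}"
      unfolding arc_rainbow_iff_inj[symmetric] by (rule windows[OF loc]) (use assms(3) in simp)
    show ?thesis
    proof (rule inj_onI)
      fix x y assume xy: "x \<in> {0..<w}" "y \<in> {0..<w}" "c x = c y"
      then have "?f (Suc x) = ?f (Suc y)" using f[of x] f[of y] by simp
      then have "Suc x = Suc y" by (rule inj_onD[OF inj]) (use xy in auto)
      then show "x = y" by simp
    qed
  qed
  moreover have "c ` {0..<w} \<subseteq> {1..k}" using loc assms(3) by (auto simp: cyc_locating_def)
  ultimately obtain \<pi> where \<pi>: "bij_betw \<pi> {1..k} {1..k}" "\<forall>i < w. \<pi> (c i) = i + 1"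
    using ex_normalizing_permutation by blast
  let ?c = "\<pi> \<circ> c"
  have loc': "cyc_locating n k ?c" using loc \<pi>(1) by (rule cyc_locating_permute)
  then have "\<forall>v < n. 1 \<le> ?c v \<and> ?c v \<le> k" "cyc_rainbow n ?c" by (simp_all add: cyc_locating_def)
  then have "map ?c [0..<n] \<in> set (window_lists w k n)" "half_rainbow n (map ?c [0..<n])"
    using window_lists_complete[of n ?c k w n] half_rainbow_if_cyc_rainbow[of n ?c]
      windows[OF loc'] \<pi>(2) by auto
  then have "map ?c [0..<n] \<in> set (filter (half_rainbow n) (window_lists w k n))"
    unfolding set_filter by blast
  moreover have "cyc_locating n k ((!) (map ?c [0..<n]))"
    using loc' by (subst cyc_locating_cong[of _ _ ?c]) simp_all
  ultimately show False using assms(1) unfolding search_fails_def by blast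
qed

lemma not_cyc_locating_count:
  assumes "k + w + 2 < n" "0 < w" "k * (n div w) < n"
  shows "\<not> cyc_locating n k c"
  using order_le_if_rainbow[of n c k w] assms by (auto simp: cyc_locating_def)

section \<open>Locating colorings\<close>

definition swap_coloring :: "nat \<Rightarrow> nat \<Rightarrow> nat" where
  "swap_coloring k i =
     (if i < k then i + 1 else if i = k then 2 else if i = k + 1 then 1 else i - k + 1)"

lemma swap_coloring_eqD:
  assumes "swap_coloring k u = swap_coloring k v" "u < v" "v < 2 * k" "4 \<le> k"
  shows "u = 0 \<and> v = k + 1 \<or> u = 1 \<and> v = k \<or> 2 \<le> u \<and> v = u + k"
  using assms by (auto simp: swap_coloring_def split: if_splits)

text \<open>Color classes have at most two vertices, far enough apart for
  \<open>cyc_rainbowI\<close>. The distance to color 3 separates the pairs of colors 1 and 2, and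
  the distance to color 1 separates all other pairs.\<close>

lemma swap_coloring_locating:
  assumes "8 \<le> n" and k: "k = (n + 1) div 2"
  shows "cyc_locating n k (swap_coloring k)"
proof -
  let ?c = "swap_coloring k"
  have k4: "4 \<le> k" "n = 2 * k \<or> n = 2 * k - 1 \<and> 5 \<le> k" using assms by presburger+
  have range: "1 \<le> ?c v \<and> ?c v \<le> k" if "v < n" for v
    using that k4 by (auto simp: swap_coloring_def)
  have classes: "set (class_list n ?c 1) = {0, k + 1}" "set (class_list n ?c 3) = {2, k + 2}"
    using k4 by (auto simp: class_list_def swap_coloring_def split: if_splits)
  have D: "Min (set (map (cdist n v) (class_list n ?c 1))) = min (cdist n v 0) (cdist n v (k + 1))"
    "Min (set (map (cdist n v) (class_list n ?c 3))) = min (cdist n v 2) (cdist n v (k + 2))" for v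
    unfolding set_map classes by simp_all
  have "cyc_rainbow n ?c"
  proof (rule cyc_rainbowI)
    fix u v assume uv: "u < v" "v < n" "?c u = ?c v"
    then have "u = 0 \<and> v = k + 1 \<or> u = 1 \<and> v = k \<or> 2 \<le> u \<and> v = u + k"
      using swap_coloring_eqD[of k u v] k4 by auto
    then show "(n - 2) div 2 \<le> cdist n u v"
    proof (elim disjE conjE)
      assume "u = 0" "v = k + 1"
      then show ?thesis using k4 by (simp add: cdist_def) arith
    next
      assume "u = 1" "v = k"
      then show ?thesis using k4 by (simp add: cdist_def) arith
    next
      assume "v = u + k"
      then show ?thesis using k4 by (simp add: cdist_def) arith
    qed
  qed
  moreover have "class_list n ?c i \<noteq> []" if "i \<in> set [1..<k + 1]" for i
  proof -
    have "i - 1 \<in> set (class_list n ?c i)"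
      using that k4 by (auto simp: class_list_def swap_coloring_def)
    then show ?thesis by auto
  qed
  moreover have "cyc_code n k ?c u \<noteq> cyc_code n k ?c v" if uv: "u < v" "v < n" for u v
  proof
    assume eq: "cyc_code n k ?c u = cyc_code n k ?c v"
    have "?c u = ?c v"
      using cyc_code_eq_imp_color_eq[OF eq] uv range by simp
    then have "u = 0 \<and> v = k + 1 \<or> u = 1 \<and> v = k \<or> 2 \<le> u \<and> v = u + k"
      using swap_coloring_eqD[of k u v] k4 uv by auto
    moreover have "min (cdist n u 0) (cdist n u (k + 1)) = min (cdist n v 0) (cdist n v (k + 1))"
      using eq k4 unfolding cyc_code_def D[symmetric] by simp
    moreover have "min (cdist n u 2) (cdist n u (k + 2)) = min (cdist n v 2) (cdist n v (k + 2))"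
      using eq k4 unfolding cyc_code_def D[symmetric] by simp
    ultimately show False
    proof (elim disjE conjE)
      assume "u = 0" "v = k + 1"
      moreover have "2 \<le> cdist n 0 2" "2 \<le> cdist n 0 (k + 2)" "cdist n (k + 1) (k + 2) = 1"
        using k4 by (auto simp: cdist_def)
      ultimately show False
        using \<open>min (cdist n u 2) (cdist n u (k + 2)) = min (cdist n v 2) (cdist n v (k + 2))\<close> by simp
    next
      assume "u = 1" "v = k"
      moreover have "cdist n 1 2 = 1" "2 \<le> cdist n k 2" "cdist n k (k + 2) = 2"
        using k4 by (auto simp: cdist_def)
      ultimately show False
        using \<open>min (cdist n u 2) (cdist n u (k + 2)) = min (cdist n v 2) (cdist n v (k + 2))\<close> by simp
    next
      assume *: "2 \<le> u" "v = u + k"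
      have "u < k" using * uv k4 by auto
      \<comment> \<open>\<open>v\<close> is strictly closer to color 1: its distances to
        \<open>0\<close> and \<open>k + 1\<close> are at most \<open>k - u\<close> and
        \<open>u - 1\<close>, one less than those of \<open>u\<close> to \<open>k + 1\<close> and
        \<open>0\<close>.\<close>
      have "cdist n u 0 = u" "cdist n u (k + 1) = k + 1 - u"
        using k4 * \<open>u < k\<close> by (auto simp: cdist_def)
      moreover have "cdist n v 0 \<le> k - u" "cdist n v (k + 1) = u - 1"
        using k4 * \<open>u < k\<close> by (auto simp: cdist_def)
      ultimately show False
        using \<open>min (cdist n u 0) (cdist n u (k + 1)) = min (cdist n v 0) (cdist n v (k + 1))\<close> *(1) \<open>u < k\<close>
        by linarith
    qed
  qed
  then have "distinct (map (cyc_code n k ?c) [0..<n])"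
    by (auto simp: distinct_map intro!: linorder_inj_onI)
  ultimately show ?thesis using range by (simp add: cyc_locating_def del: upt_Suc)
qed

text \<open>Witnesses for the orders below 8 and for those where one color can be saved against
  \<open>swap_coloring\<close>.\<close>

lemma cyc_locating_small:
  "cyc_locating 3 3 ((!) [1, 2, 3])"
  "cyc_locating 4 3 ((!) [1, 1, 2, 3])"
  "cyc_locating 5 3 ((!) [1, 1, 1, 2, 3])"
  "cyc_locating 6 3 ((!) [1, 1, 1, 1, 2, 3])"
  "cyc_locating 7 3 ((!) [1, 2, 1, 2, 1, 2, 3])"
  "cyc_locating 9 4 ((!) [1, 2, 1, 2, 3, 2, 1, 4, 3])"
  "cyc_locating 11 5 ((!) [1, 2, 3, 1, 2, 4, 1, 2, 3, 5, 4])"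
  "cyc_locating 12 5 ((!) [1, 2, 3, 4, 1, 2, 5, 3, 1, 2, 4, 5])"
  "cyc_locating 13 6 ((!) [1, 2, 3, 4, 1, 2, 5, 3, 1, 2, 4, 6, 5])"
  "cyc_locating 15 7 ((!) [1, 2, 3, 4, 5, 1, 6, 2, 7, 3, 1, 4, 5, 6, 7])"
  by code_simp+

text \<open>For orders up to 6 the windows have length 1 and restrict nothing. For 8, 9 and 10 the
  window length is \<open>n - k - 3\<close>, the largest that \<open>window_rainbow\<close>
  allows.\<close>

lemma search_fails_small:
  "search_fails 3 1 1"
  "search_fails 3 2 1"
  "search_fails 4 1 1"
  "search_fails 4 2 1"
  "search_fails 5 1 1"
  "search_fails 5 2 1"
  "search_fails 6 1 1"
  "search_fails 6 2 1"
  "search_fails 8 3 2"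
  "search_fails 9 3 3"
  "search_fails 10 4 3"
  by code_simp+

section \<open>The locating rainbow connection number of cycles\<close>

context cycle
begin

text \<open>The hypotheses of the counting bound only get easier with fewer colors, so checking
  \<open>k - 1\<close> colors excludes all smaller numbers with the same \<open>w\<close>.\<close>

lemma rvcl_eq_if_count:
  assumes "cyc_locating n k c" "1 \<le> k" "k + w + 1 < n" "0 < w" "(k - 1) * (n div w) < n"
  shows "rvcl = k"
proof (rule rvcl_eqI[OF assms(1,2)])
  fix j c assume "1 \<le> j" "j < k"
  then have "j * (n div w) \<le> (k - 1) * (n div w)" by (intro mult_right_mono) auto
  then have "j * (n div w) < n" using assms(5) by (rule le_less_trans)
  then show "\<not> cyc_locating n j c"
    using \<open>j < k\<close> assms by (intro not_cyc_locating_count[of _ w]) auto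
qed

text \<open>The search with windows \<open>w'\<close> excludes \<open>k - 1\<close> colors. Counting
  excludes \<open>k - 2\<close> and fewer, where a longer window is allowed:
  \<open>k + w < n\<close> is the counting condition for \<open>k - 2\<close> colors.\<close>

lemma rvcl_eq_if_search:
  assumes "cyc_locating n k c" "2 \<le> k"
    and "search_fails n (k - 1) w'" "k + w' + 1 < n \<or> w' = 1" "w' < n"
    and "k + w < n" "0 < w" "(k - 2) * (n div w) < n"
  shows "rvcl = k"
proof (rule rvcl_eqI[OF assms(1)])
  show "1 \<le> k" using assms(2) by simp
  fix j c assume j: "1 \<le> j" "j < k"
  show "\<not> cyc_locating n j c"
  proof (cases "j = k - 1")
    case True
    then show ?thesis using assms(2-5) by (intro not_cyc_locating_search[of _ _ w']) auto
  next
    case False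
    then have "j * (n div w) \<le> (k - 2) * (n div w)" using j by (intro mult_right_mono) auto
    then have "j * (n div w) < n" using assms(8) by (rule le_less_trans)
    then show ?thesis using False j assms by (intro not_cyc_locating_count[of _ w]) auto
  qed
qed

lemma rvcl_eq_half:
  assumes "n = 14 \<or> n \<ge> 16"
  shows "rvcl = (n + 1) div 2"
proof -
  define k where "k = (n + 1) div 2"
  \<comment> \<open>The largest \<open>w\<close> with \<open>k + w + 1 < n\<close>. Classes then
    have at most two vertices if \<open>n < 3 * w\<close>, which holds exactly for
    \<open>n = 14\<close> and \<open>n \<ge> 16\<close>; this is where the exceptional orders come
    from.\<close>
  define w where "w = n div 2 - 2"
  have w: "0 < w" "n < 3 * w" "k + w + 1 < n" "2 * (k - 1) < n" "1 \<le> k" "8 \<le> n"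
    using assms unfolding k_def w_def by presburger+
  then have "n div w \<le> 2" using div_less_iff_less_mult[of w n 3] by simp
  then have "(k - 1) * (n div w) \<le> (k - 1) * 2" by (rule mult_left_mono) simp
  then have "(k - 1) * (n div w) < n"
    by (rule le_less_trans) (use w(4) in simp)
  with swap_coloring_locating[OF w(6) k_def] w(5,3,1) show ?thesis
    unfolding k_def[symmetric] by (rule rvcl_eq_if_count)
qed

end

theorem theorem4:
  fixes n :: nat
  assumes "n \<ge> 3"
  shows
    "(n \<in> {3, 4, 5, 6, 7} \<longrightarrow>
        connected_pair_graph.rvcl (cycle_graph n) = 3) \<and>
     (n \<in> {9, 11, 12, 13, 15} \<longrightarrow>
        int (connected_pair_graph.rvcl (cycle_graph n)) = \<lceil>real n / 2\<rceil> - 1) \<and>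
     (n \<in> {8, 10, 14} \<or> n \<ge> 16 \<longrightarrow>
        int (connected_pair_graph.rvcl (cycle_graph n)) = \<lceil>real n / 2\<rceil>)"
proof -
  interpret cycle n using assms by unfold_locales
  have half: "\<lceil>real n / 2\<rceil> = int ((n + 1) div 2)"
    by (rule ceiling_unique) (cases "even n"; auto elim!: evenE oddE)+
  have tiny: "rvcl = 3"
    if "cyc_locating n 3 c" "search_fails n 1 1" "search_fails n 2 1" for c
  proof (rule rvcl_eqI[OF that(1)])
    fix j :: nat and c' assume "1 \<le> j" "j < 3"
    then have "j = 1 \<or> j = 2" by auto
    then show "\<not> cyc_locating n j c'" using not_cyc_locating_search[of n j 1 c'] that n3 by auto
  qed simp
  have "rvcl = 3" if "n \<in> {3, 4, 5, 6}"
    using that tiny cyc_locating_small search_fails_small by auto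
  \<comment> \<open>In all the counting cases below the window length is \<open>n - k - 2\<close>,
    the largest permitted.\<close>
  moreover have "rvcl = 3" if "n = 7"
    using rvcl_eq_if_count[of 3 _ 2] cyc_locating_small(5) that by simp
  moreover have "rvcl = 4" if "n = 8"
    using rvcl_eq_if_search[of 4 _ 2 3] swap_coloring_locating[of n 4] search_fails_small(9) that by simp
  moreover have "rvcl = 4" if "n = 9"
    using rvcl_eq_if_search[of 4 _ 3 3] cyc_locating_small(6) search_fails_small(10) that by simp
  moreover have "rvcl = 5" if "n = 10"
    using rvcl_eq_if_search[of 5 _ 3 4] swap_coloring_locating[of n 5] search_fails_small(11) that by simp
  moreover have "rvcl = 5" if "n = 11"
    using rvcl_eq_if_count[of 5 _ 4] cyc_locating_small(7) that by simp
  moreover have "rvcl = 5" if "n = 12"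
    using rvcl_eq_if_count[of 5 _ 5] cyc_locating_small(8) that by simp
  moreover have "rvcl = 6" if "n = 13"
    using rvcl_eq_if_count[of 6 _ 5] cyc_locating_small(9) that by simp
  moreover have "rvcl = 7" if "n = 15"
    using rvcl_eq_if_count[of 7 _ 6] cyc_locating_small(10) that by simp
  ultimately show ?thesis
    using rvcl_eq_half unfolding half by auto
qed

end
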